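(* The property of an exponential vector space over $\mathbb{K}$ ($=\mathbb{R}$ or $\mathbb{C}$) to be radial is an evs property; that is, if $X$ and $Y$ are order-isomorphic exponential vector spaces over $\mathbb{K}$ and $X$ is radial, then $Y$ is radial.
   Context: An exponential vector space (evs) over a field $K$ is a partially ordered set $(X,\leq)$ with a binary operation $+$ on $X$ and a scalar multiplication $\cdot:K\times X\to X$ such that for all $x,y,z\in X$, $\alpha,\beta\in K$: ($A_1$) $(X,+)$ is a commutative semigroup with identity $\theta$; ($A_2$) $x\leq y$ implies $x+z\leq y+z$ and $\alpha\cdot x\leq\alpha\cdot y$; ($A_3$) $\alpha\cdot(x+y)=\alpha\cdot x+\alpha\cdot y$, $\alpha\cdot(\beta\cdot x)=(\alpha\beta)\cdot x$, $(\alpha+\beta)\cdot x\leq\alpha\cdot x+\beta\cdot x$, $1\cdot x=x$; ($A_4$) $\alpha\cdot x=\theta$ iff $\alpha=0$ or $x=\theta$; ($A_5$) $x+(-1)\cdot x=\theta$ iff $x\in X_0:=\{z\in X: y\nleq z\ \forall y\in X\smallsetminus\{z\}\}$ (the set of minimal elements); ($A_6$) for each $x\in X$ there is $p\in X_0$ with $p\leq x$. An order-morphism between evs $X,Y$ over a common field $K$ is a map $f:X\to Y$ with (i) $f(x+y)=f(x)+f(y)$; (ii) $f(\alpha x)=\alpha f(x)$ for all $\alpha\in K$; (iii) $x\leq y\Rightarrow f(x)\leq f(y)$; (iv) for $p,q\in f(X)$ with $p\leq q$: $f^{-1}(p)\subseteq\downarrow f^{-1}(q)$ and $f^{-1}(q)\subseteq\uparrow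 f^{-1}(p)$, where $\uparrow A=\{x:x\geq a\text{ for some }a\in A\}$, $\downarrow A=\{x:x\leq a\text{ for some }a\in A\}$. A bijective order-morphism is an order-isomorphism. An evs property is a property of evs that is invariant under order-isomorphism. For an evs $X$ over $\mathbb{K}$, a set $A\subseteq X$ is absorbing if for every $x\in X$ there is a real $\alpha>0$ such that $\mu x\in A$ for all $\mu\in\mathbb{K}$ with $|\mu|\leq\alpha$. The evs $X$ is radial if for any $x,y\in X$ with $x\neq y$ there is an absorbing set which contains one of $x$ and $y$ but not both. *)

theory Defs
  imports Complex_Main "HOL-Algebra.Group"
begin

record ('k, 'x) evs = "'x partial_object" +
  evs_add :: "'x \<Rightarrow> 'x \<Rightarrow> 'x" (infixl "+\<^sub>e\<index>" 65)
  evs_theta :: "'x" ("\<theta>\<index>")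
  evs_smul :: "'k \<Rightarrow> 'x \<Rightarrow> 'x" (infixr "\<cdot>\<^sub>e\<index>" 75)
  evs_le :: "'x \<Rightarrow> 'x \<Rightarrow> bool" (infix "\<le>\<^sub>e\<index>" 50)

definition minimal_elements :: "('k, 'x) evs \<Rightarrow> 'x set" where
  "minimal_elements X = {z \<in> carrier X. \<forall>y \<in> carrier X - {z}. \<not> y \<le>\<^sub>e\<^bsub>X\<^esub> z}"

locale exp_vector_space =
  fixes X :: "('k::field, 'x) evs" (structure)
  assumes partial_order:
      "partial_order_on (carrier X) {(x, y). x \<in> carrier X \<and> y \<in> carrier X \<and> x \<le>\<^sub>e y}"
    and add_comm_monoid:
      "comm_monoid \<lparr>carrier = carrier X, mult = evs_add X, one = \<theta>\<rparr>"
    and smul_closed: "x \<in> carrier X \<Longrightarrow> \<alpha> \<cdot>\<^sub>e x \<in> carrier X"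
    and add_mono: "\<lbrakk>x \<in> carrier X; y \<in> carrier X; z \<in> carrier X; x \<le>\<^sub>e y\<rbrakk>
      \<Longrightarrow> x +\<^sub>e z \<le>\<^sub>e y +\<^sub>e z"
    and smul_mono: "\<lbrakk>x \<in> carrier X; y \<in> carrier X; x \<le>\<^sub>e y\<rbrakk> \<Longrightarrow> \<alpha> \<cdot>\<^sub>e x \<le>\<^sub>e \<alpha> \<cdot>\<^sub>e y"
    and smul_add: "\<lbrakk>x \<in> carrier X; y \<in> carrier X\<rbrakk>
      \<Longrightarrow> \<alpha> \<cdot>\<^sub>e (x +\<^sub>e y) = (\<alpha> \<cdot>\<^sub>e x) +\<^sub>e (\<alpha> \<cdot>\<^sub>e y)"
    and smul_smul: "x \<in> carrier X \<Longrightarrow> \<alpha> \<cdot>\<^sub>e (\<beta> \<cdot>\<^sub>e x) = (\<alpha> * \<beta>) \<cdot>\<^sub>e x"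
    and add_smul_le: "x \<in> carrier X \<Longrightarrow> (\<alpha> + \<beta>) \<cdot>\<^sub>e x \<le>\<^sub>e (\<alpha> \<cdot>\<^sub>e x) +\<^sub>e (\<beta> \<cdot>\<^sub>e x)"
    and one_smul: "x \<in> carrier X \<Longrightarrow> 1 \<cdot>\<^sub>e x = x"
    and smul_eq_theta_iff: "x \<in> carrier X \<Longrightarrow> \<alpha> \<cdot>\<^sub>e x = \<theta> \<longleftrightarrow> \<alpha> = 0 \<or> x = \<theta>"
    and add_neg_eq_theta_iff: "x \<in> carrier X
      \<Longrightarrow> x +\<^sub>e ((- 1) \<cdot>\<^sub>e x) = \<theta> \<longleftrightarrow> x \<in> minimal_elements X"
    and minimal_below: "x \<in> carrier X \<Longrightarrow> \<exists>p \<in> minimal_elements X. p \<le>\<^sub>e x"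

definition up_set :: "('k, 'x) evs \<Rightarrow> 'x set \<Rightarrow> 'x set" where
  "up_set X A = {x \<in> carrier X. \<exists>a \<in> A. a \<le>\<^sub>e\<^bsub>X\<^esub> x}"

definition down_set :: "('k, 'x) evs \<Rightarrow> 'x set \<Rightarrow> 'x set" where
  "down_set X A = {x \<in> carrier X. \<exists>a \<in> A. x \<le>\<^sub>e\<^bsub>X\<^esub> a}"

definition fibre :: "('k, 'x) evs \<Rightarrow> ('x \<Rightarrow> 'y) \<Rightarrow> 'y \<Rightarrow> 'x set" where
  "fibre X f p = {x \<in> carrier X. f x = p}"

definition order_morphism :: "('k, 'x) evs \<Rightarrow> ('k, 'y) evs \<Rightarrow> ('x \<Rightarrow> 'y) \<Rightarrow> bool" where
  "order_morphism X Y f \<longleftrightarrow>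
     f \<in> carrier X \<rightarrow> carrier Y \<and>
     (\<forall>x \<in> carrier X. \<forall>y \<in> carrier X. f (x +\<^sub>e\<^bsub>X\<^esub> y) = f x +\<^sub>e\<^bsub>Y\<^esub> f y) \<and>
     (\<forall>\<alpha>. \<forall>x \<in> carrier X. f (\<alpha> \<cdot>\<^sub>e\<^bsub>X\<^esub> x) = \<alpha> \<cdot>\<^sub>e\<^bsub>Y\<^esub> f x) \<and>
     (\<forall>x \<in> carrier X. \<forall>y \<in> carrier X. x \<le>\<^sub>e\<^bsub>X\<^esub> y \<longrightarrow> f x \<le>\<^sub>e\<^bsub>Y\<^esub> f y) \<and>
     (\<forall>p \<in> f ` carrier X. \<forall>q \<in> f ` carrier X. p \<le>\<^sub>e\<^bsub>Y\<^esub> q \<longrightarrow>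
        fibre X f p \<subseteq> down_set X (fibre X f q) \<and>
        fibre X f q \<subseteq> up_set X (fibre X f p))"

definition order_isomorphism :: "('k, 'x) evs \<Rightarrow> ('k, 'y) evs \<Rightarrow> ('x \<Rightarrow> 'y) \<Rightarrow> bool" where
  "order_isomorphism X Y f \<longleftrightarrow> order_morphism X Y f \<and> bij_betw f (carrier X) (carrier Y)"

definition order_isomorphic :: "('k, 'x) evs \<Rightarrow> ('k, 'y) evs \<Rightarrow> bool" where
  "order_isomorphic X Y \<longleftrightarrow> (\<exists>f. order_isomorphism X Y f)"

(* Only used for the scalar fields real and complex, where norm is the absolute value. *)
definition absorbing :: "('k::real_normed_field, 'x) evs \<Rightarrow> 'x set \<Rightarrow> bool" where
  "absorbing X A \<longleftrightarrow> A \<subseteq> carrier X \<and>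
     (\<forall>x \<in> carrier X. \<exists>\<alpha>::real. \<alpha> > 0 \<and> (\<forall>\<mu>. norm \<mu> \<le> \<alpha> \<longrightarrow> \<mu> \<cdot>\<^sub>e\<^bsub>X\<^esub> x \<in> A))"

definition radial :: "('k::real_normed_field, 'x) evs \<Rightarrow> bool" where
  "radial X \<longleftrightarrow> (\<forall>x \<in> carrier X. \<forall>y \<in> carrier X. x \<noteq> y \<longrightarrow>
     (\<exists>A. absorbing X A \<and> (x \<in> A \<longleftrightarrow> y \<notin> A)))"

end

theory Submission
  imports Defs
begin

text \<open>
  Absorption refers only to the scalar multiplication, and an order-isomorphism \<open>f\<close> from \<open>X\<close> to \<open>Y\<close>
  commutes with it. So the image under \<open>f\<close> of an absorbing set is absorbing: every point of \<open>Y\<close> is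
  some \<open>f x\<close>, and a radius \<open>\<alpha>\<close> that works for \<open>x\<close> works for \<open>f x\<close>
  (\<open>absorbing_image\<close>). Two distinct points of \<open>Y\<close> have distinct preimages; if \<open>A\<close> separates the
  preimages, then \<open>f ` A\<close> separates the points, by injectivity (\<open>radial_order_isomorphism\<close>).
  The argument is the same for all normed scalar fields, in particular for the reals and the complex
  numbers.
\<close>

lemma absorbing_image:
  fixes X :: "('k::real_normed_field, 'x) evs" and Y :: "('k, 'y) evs"
  assumes "absorbing X A"
    and surj: "f ` carrier X = carrier Y"
    and smul: "\<And>\<mu> x. x \<in> carrier X \<Longrightarrow> f (\<mu> \<cdot>\<^sub>e\<^bsub>X\<^esub> x) = \<mu> \<cdot>\<^sub>e\<^bsub>Y\<^esub> f x"
  shows "absorbing Y (f ` A)"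
  unfolding absorbing_def
proof (intro conjI ballI)
  show "f ` A \<subseteq> carrier Y"
    using assms(1) surj unfolding absorbing_def by blast
next
  fix y assume "y \<in> carrier Y"
  then obtain x where x: "x \<in> carrier X" "y = f x"
    using surj by blast
  then obtain \<alpha> :: real where "\<alpha> > 0" and \<alpha>: "\<And>\<mu>. norm \<mu> \<le> \<alpha> \<Longrightarrow> \<mu> \<cdot>\<^sub>e\<^bsub>X\<^esub> x \<in> A"
    using assms(1) unfolding absorbing_def by blast
  moreover have "\<mu> \<cdot>\<^sub>e\<^bsub>Y\<^esub> y \<in> f ` A" if "norm \<mu> \<le> \<alpha>" for \<mu>
    using imageI[OF \<alpha>[OF that], of f] smul[OF x(1)] x(2) by simp
  ultimately show "\<exists>\<alpha>::real. \<alpha> > 0 \<and> (\<forall>\<mu>. norm \<mu> \<le> \<alpha> \<longrightarrow> \<mu> \<cdot>\<^sub>e\<^bsub>Y\<^esub> y \<in> f ` A)"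
    by blast
qed

lemma radial_order_isomorphism:
  fixes X :: "('k::real_normed_field, 'x) evs" and Y :: "('k, 'y) evs"
  assumes "order_isomorphism X Y f" and "radial X"
  shows "radial Y"
  unfolding radial_def
proof (intro ballI impI)
  have smul: "f (\<mu> \<cdot>\<^sub>e\<^bsub>X\<^esub> x) = \<mu> \<cdot>\<^sub>e\<^bsub>Y\<^esub> f x" if "x \<in> carrier X" for \<mu> x
    using assms(1) that unfolding order_isomorphism_def order_morphism_def by blast
  have inj: "inj_on f (carrier X)" and surj: "f ` carrier X = carrier Y"
    using assms(1) unfolding order_isomorphism_def bij_betw_def by auto
  fix u v assume "u \<in> carrier Y" "v \<in> carrier Y" "u \<noteq> v"
  then obtain x y where x: "x \<in> carrier X" "u = f x" and y: "y \<in> carrier X" "v = f y"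
    using surj by blast
  then have "x \<noteq> y"
    using \<open>u \<noteq> v\<close> by blast
  then obtain A where A: "absorbing X A" "x \<in> A \<longleftrightarrow> y \<notin> A"
    using assms(2) x(1) y(1) unfolding radial_def by blast
  have "A \<subseteq> carrier X"
    using A(1) unfolding absorbing_def by blast
  then have "u \<in> f ` A \<longleftrightarrow> v \<notin> f ` A"
    using A(2) x y inj by (simp add: inj_on_image_mem_iff)
  then show "\<exists>B. absorbing Y B \<and> (u \<in> B \<longleftrightarrow> v \<notin> B)"
    using absorbing_image[OF A(1) surj smul] by blast
qed

theorem theorem6p2:
  shows "(\<forall>(X :: (real, 'x) evs) (Y :: (real, 'y) evs).
            exp_vector_space X \<longrightarrow> exp_vector_space Y \<longrightarrow> order_isomorphic X Y \<longrightarrow>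
            radial X \<longrightarrow> radial Y)
       \<and> (\<forall>(X :: (complex, 'x) evs) (Y :: (complex, 'y) evs).
            exp_vector_space X \<longrightarrow> exp_vector_space Y \<longrightarrow> order_isomorphic X Y \<longrightarrow>
            radial X \<longrightarrow> radial Y)"
  by (auto simp: order_isomorphic_def intro: radial_order_isomorphism)

end
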